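(* Let $\sigma>0$ and $p\ge c>0$. For $N\ge1$ and $\kappa\in\mathbb{R}$ let $$J_N(\kappa)=c\,\sigma\kappa N^{1/2}+p\,\mathbf{E}[L_N(\kappa)],\qquad J_N^*=\inf_{\kappa\in\mathbb{R}}J_N(\kappa),$$ where $L_N(\kappa)=\max_{0\le n\le N}S_n(\kappa)$, $S_0(\kappa)=0$, $S_n(\kappa)=\sigma\sum_{i=1}^nZ_i-\kappa\sigma\sqrt n$ for $n\ge1$, and $Z_1,Z_2,\dots$ are i.i.d. standard normal random variables. Let $\kappa^*$ be an optimal solution of $$\min_{\kappa\in\mathbb{R}}\ \ c\,\sigma\kappa N^{1/2}+p\,\sigma\rho(\kappa)N^{1/2},\qquad \rho(\kappa)=\mathbf{E}\Bigl[\sup_{0\le t\le1}\bigl(B_t-\kappa\sqrt t\bigr)\Bigr],$$ where $(B_t)$ is a standard Brownian motion (so that the set of optimal solutions does not depend on $N$). Then $\kappa^*$ is asymptotically optimal for the problem of minimizing $J_N$, i.e. $$\limsup_{N\to\infty}\frac{J_N(\kappa^* )}{J_N^*}\le1 .$$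
   Context: Here $c$ is the per-unit production cost, $p$ the per-unit lost-sales penalty, and $L_N(\kappa)$ the cumulative lost sales when the cumulative supply exceeds the cumulative mean demand by $\kappa\sigma\sqrt n$ up to each period $n$. *)

theory Defs
  imports "HOL-Probability.Probability"
begin

text \<open>
  Only the restriction of \<open>B\<close> to nonnegative times matters. All paths are continuous, which makes
  the supremum over a compact time interval finite and measurable.
\<close>

definition standard_brownian_motion :: "'b measure \<Rightarrow> (real \<Rightarrow> 'b \<Rightarrow> real) \<Rightarrow> bool" where
  "standard_brownian_motion M B \<longleftrightarrow>
     prob_space M \<and>
     (\<forall>t\<ge>0. B t \<in> borel_measurable M) \<and>
     (\<forall>\<omega>\<in>space M. B 0 \<omega> = 0) \<and>
     (\<forall>(n::nat) (t::nat \<Rightarrow> real). 0 \<le> t 0 \<longrightarrow> mono_on {..n} t \<longrightarrow>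
        prob_space.indep_vars M (\<lambda>_. borel) (\<lambda>i \<omega>. B (t (Suc i)) \<omega> - B (t i) \<omega>) {..<n}) \<and>
     (\<forall>s t. 0 \<le> s \<longrightarrow> s < t \<longrightarrow>
        distributed M lborel (\<lambda>\<omega>. B t \<omega> - B s \<omega>) (normal_density 0 (sqrt (t - s)))) \<and>
     (\<forall>\<omega>\<in>space M. continuous_on {0..} (\<lambda>t. B t \<omega>))"

definition walk :: "(nat \<Rightarrow> 'a \<Rightarrow> real) \<Rightarrow> real \<Rightarrow> real \<Rightarrow> nat \<Rightarrow> 'a \<Rightarrow> real" where
  "walk Z \<sigma> \<kappa> n \<omega> = \<sigma> * (\<Sum>i=1..n. Z i \<omega>) - \<kappa> * \<sigma> * sqrt (real n)"

lemma walk_0 [simp]: "walk Z \<sigma> \<kappa> 0 \<omega> = 0"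
  by (simp add: walk_def)

definition lost_sales :: "(nat \<Rightarrow> 'a \<Rightarrow> real) \<Rightarrow> real \<Rightarrow> nat \<Rightarrow> real \<Rightarrow> 'a \<Rightarrow> real" where
  "lost_sales Z \<sigma> N \<kappa> \<omega> = Max ((\<lambda>n. walk Z \<sigma> \<kappa> n \<omega>) ` {0..N})"

definition cost ::
  "'a measure \<Rightarrow> (nat \<Rightarrow> 'a \<Rightarrow> real) \<Rightarrow> real \<Rightarrow> real \<Rightarrow> real \<Rightarrow> nat \<Rightarrow> real \<Rightarrow> real" where
  "cost M Z \<sigma> c p N \<kappa> =
     c * \<sigma> * \<kappa> * sqrt (real N) + p * prob_space.expectation M (lost_sales Z \<sigma> N \<kappa>)"

text \<open>
  For \<open>0 < c \<le> p\<close> and standard normal \<open>Z\<close> the cost is bounded below by \<open>0\<close>, because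
  \<open>lost_sales Z \<sigma> N \<kappa> \<omega> \<ge> max 0 (walk Z \<sigma> \<kappa> N \<omega>)\<close>; so the real-valued infimum is the true one.
\<close>

definition optimal_cost ::
  "'a measure \<Rightarrow> (nat \<Rightarrow> 'a \<Rightarrow> real) \<Rightarrow> real \<Rightarrow> real \<Rightarrow> real \<Rightarrow> nat \<Rightarrow> real" where
  "optimal_cost M Z \<sigma> c p N = (INF \<kappa>. cost M Z \<sigma> c p N \<kappa>)"

definition rho :: "'b measure \<Rightarrow> (real \<Rightarrow> 'b \<Rightarrow> real) \<Rightarrow> real \<Rightarrow> real" where
  "rho M B \<kappa> = prob_space.expectation M (\<lambda>\<omega>. SUP t\<in>{0..1}. B t \<omega> - \<kappa> * sqrt t)"

definition brownian_cost ::
  "'b measure \<Rightarrow> (real \<Rightarrow> 'b \<Rightarrow> real) \<Rightarrow> real \<Rightarrow> real \<Rightarrow> real \<Rightarrow> nat \<Rightarrow> real \<Rightarrow> real" where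
  "brownian_cost M B \<sigma> c p N \<kappa> =
     c * \<sigma> * \<kappa> * sqrt (real N) + p * \<sigma> * rho M B \<kappa> * sqrt (real N)"

lemma brownian_cost_optimal_indep:
  assumes "N \<ge> 1" "N' \<ge> 1"
  shows "is_arg_min (brownian_cost M B \<sigma> c p N) (\<lambda>_. True) \<kappa> \<longleftrightarrow>
         is_arg_min (brownian_cost M B \<sigma> c p N') (\<lambda>_. True) \<kappa>"
proof -
  have eq: "brownian_cost M B \<sigma> c p n x =
      (c * \<sigma> * x + p * \<sigma> * rho M B x) * sqrt (real n)" for n x
    by (simp add: brownian_cost_def distrib_right)
  have "brownian_cost M B \<sigma> c p n x < brownian_cost M B \<sigma> c p n y \<longleftrightarrow>
      c * \<sigma> * x + p * \<sigma> * rho M B x < c * \<sigma> * y + p * \<sigma> * rho M B y" if "n \<ge> 1" for n x y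
    using that unfolding eq by (intro mult_less_cancel_right_pos) simp
  with assms show ?thesis
    by (simp add: is_arg_min_def)
qed

end

theory Submission
  imports Defs
begin

text \<open>
  Brownian scaling turns the problem with \<open>N\<close> periods into a discretised Brownian problem: the walk
  \<open>\<Sum>i\<le>n. Z i\<close> for \<open>n \<le> N\<close> has the law of \<open>sqrt N * B (n / N)\<close>, so
  \<open>cost N \<kappa> = \<sigma> * sqrt N * (c * \<kappa> + p * \<rho>\<^sub>N \<kappa>)\<close>, where \<open>\<rho>\<^sub>N \<kappa>\<close> is the expected maximum of
  \<open>B t - \<kappa> * sqrt t\<close> over the grid \<open>{0, 1/N, \<dots>, 1}\<close>; this is
  \<open>expectation_lost_sales_eq_grid_rho\<close>. Let \<open>\<rho> \<kappa>\<close> be the expected supremum over all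
  \<open>t \<in> {0..1}\<close>, and \<open>g \<kappa> = c * \<kappa> + p * \<rho> \<kappa>\<close> be the Brownian cost
  per unit of \<open>\<sigma> * sqrt N\<close>. As \<open>\<rho>\<^sub>N \<le> \<rho>\<close>, the minimiser \<open>\<kappa>s\<close> of \<open>g\<close> costs at most
  \<open>\<sigma> * sqrt N * g \<kappa>s\<close>. What is needed beyond this is a lower bound on the optimal cost, and hence
  an estimate \<open>\<rho> \<kappa> \<le> \<rho>\<^sub>N \<kappa> + \<epsilon>\<^sub>N\<close> with \<open>\<epsilon>\<^sub>N \<longlonglongrightarrow> 0\<close> uniformly in \<open>\<kappa>\<close> over the whole real
  line. It makes the optimal cost at least \<open>\<sigma> * sqrt N * (g \<kappa>s - p * \<epsilon>\<^sub>N)\<close>, and the ratio at most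
  \<open>g \<kappa>s / (g \<kappa>s - p * \<epsilon>\<^sub>N)\<close>, which tends to 1 because \<open>g \<kappa>s > 0\<close> (\<open>unit_cost_pos\<close>).

  The uniform estimate (\<open>rho_le_grid_rho\<close>) is a chaining argument. When the grid is refined from
  \<open>m\<close> to \<open>2 * m\<close> intervals, each new point is compared with its left neighbour if \<open>\<kappa> \<ge> 0\<close> and
  with its right neighbour if \<open>\<kappa> < 0\<close>: then the drift at the neighbour is at least as favourable,
  and only the increment of \<open>B\<close> is lost, whatever \<open>\<kappa>\<close> is. The fourth moment
  \<open>3 * (t - s)\<^sup>2\<close> of an increment bounds the expected largest of the \<open>m\<close> increments over intervals
  of length \<open>1 / m\<close> by \<open>4 * m powr (-1/4)\<close>. These bounds form a geometric series along the grids
  with \<open>N * 2 ^ j\<close> intervals. Monotone convergence along the same grids yields both the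
  integrability of the supremum and \<open>\<epsilon>\<^sub>N = C * N powr (-1/4)\<close>.
\<close>

section \<open>Maxima over equidistant grids\<close>

definition grid_max :: "(real \<Rightarrow> real) \<Rightarrow> nat \<Rightarrow> real" where
  "grid_max f m = Max ((\<lambda>k. f (real k / real m)) ` {0..m})"

lemma grid_max_ge: "k \<le> m \<Longrightarrow> f (real k / real m) \<le> grid_max f m"
  unfolding grid_max_def by (intro Max_ge) auto

lemma grid_max_le: "(\<And>k. k \<le> m \<Longrightarrow> f (real k / real m) \<le> a) \<Longrightarrow> grid_max f m \<le> a"
  unfolding grid_max_def by (intro Max.boundedI) auto

lemma grid_max_double_ge:
  assumes "m \<ge> 1"
  shows "grid_max f m \<le> grid_max f (2 * m)"
proof (rule grid_max_le)
  fix k assume "k \<le> m"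
  then show "f (real k / real m) \<le> grid_max f (2 * m)"
    using grid_max_ge[of "2 * k" "2 * m" f] by simp
qed

text \<open>
  The drift \<open>- \<kappa> * sqrt t\<close> is monotone in \<open>t\<close>, so one of the two neighbours of a new grid point has
  a drift at least as large as its own. This is why the increments of \<open>b\<close> alone bound the gain from
  refining the grid, with a bound that does not depend on \<open>\<kappa>\<close>.
\<close>

lemma grid_max_double_le:
  fixes b :: "real \<Rightarrow> real" and \<kappa> :: real
  assumes m: "m \<ge> 1"
    and d: "\<And>k. k < 2 * m \<Longrightarrow> \<bar>b (real (Suc k) / real (2 * m)) - b (real k / real (2 * m))\<bar> \<le> d"
  defines "h \<equiv> \<lambda>t. b t - \<kappa> * sqrt t"
  shows "grid_max h (2 * m) \<le> grid_max h m + d"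
proof (rule grid_max_le)
  have d0: "0 \<le> d"
    using d[of 0] m by linarith
  fix k assume k: "k \<le> 2 * m"
  show "h (real k / real (2 * m)) \<le> grid_max h m + d"
  proof (cases "even k")
    case True
    then obtain j where j: "k = 2 * j" by blast
    then show ?thesis
      using grid_max_ge[of j m h] k d0 by simp
  next
    case False
    then obtain j where j: "k = Suc (2 * j)" by (auto elim: oddE)
    with k have jm: "j < m" by simp
    show ?thesis
    proof (cases "\<kappa> \<ge> 0")
      case True
      have "sqrt (real j / real m) \<le> sqrt (real k / real (2 * m))"
        using m j by (simp add: field_simps)
      then have "\<kappa> * sqrt (real j / real m) \<le> \<kappa> * sqrt (real k / real (2 * m))"
        using True by (rule mult_left_mono)
      moreover have "real (2 * j) / real (2 * m) = real j / real m"
        by simp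
      moreover have "b (real k / real (2 * m)) \<le> b (real (2 * j) / real (2 * m)) + d"
        using d[of "2 * j"] jm unfolding j by (simp only: abs_le_iff) auto
      ultimately show ?thesis
        using grid_max_ge[of j m h] jm unfolding h_def by simp
    next
      case False
      have "sqrt (real k / real (2 * m)) \<le> sqrt (real (Suc j) / real m)"
        using m j by (simp add: field_simps)
      then have "\<kappa> * sqrt (real (Suc j) / real m) \<le> \<kappa> * sqrt (real k / real (2 * m))"
        using False by (intro mult_left_mono_neg) auto
      moreover have "real (Suc k) / real (2 * m) = real (Suc j) / real m"
        using j m by (simp add: field_simps)
      moreover have "b (real k / real (2 * m)) \<le> b (real (Suc k) / real (2 * m)) + d"
        using d[of k] jm j by (simp add: abs_le_iff)
      ultimately show ?thesis
        using grid_max_ge[of "Suc j" m h] jm unfolding h_def by simp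
    qed
  qed
qed

lemma grid_max_le_SUP:
  fixes f :: "real \<Rightarrow> real"
  assumes cont: "continuous_on {0..1} f"
  shows "grid_max f m \<le> (SUP t\<in>{0..1}. f t)"
proof (rule grid_max_le)
  fix k assume "k \<le> m"
  moreover have "bdd_above (f ` {0..1})"
    using compact_continuous_image[OF cont] by (simp add: compact_imp_bounded bounded_imp_bdd_above)
  ultimately show "f (real k / real m) \<le> (SUP t\<in>{0..1}. f t)"
    by (intro cSUP_upper) (auto simp: divide_le_eq)
qed

text \<open>
  The maximum is attained at some \<open>s\<close>, and the values of \<open>f\<close> at the grid points next to the left of
  \<open>s\<close> already tend to it.
\<close>

lemma grid_max_tendsto_SUP:
  fixes f :: "real \<Rightarrow> real"
  assumes cont: "continuous_on {0..1} f" and m: "filterlim m at_top sequentially"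
  shows "(\<lambda>j. grid_max f (m j)) \<longlonglongrightarrow> (SUP t\<in>{0..1}. f t)"
proof -
  obtain s where s: "s \<in> {0..1}" "\<forall>t\<in>{0..1}. f t \<le> f s"
    using continuous_attains_sup[OF _ _ cont] by auto
  have SUP_eq: "(SUP t\<in>{0..1}. f t) = f s"
    using s by (intro cSup_eq_maximum) auto
  define k where "k j = nat \<lfloor>s * real (m j)\<rfloor>" for j
  have k_eq: "real (k j) = of_int \<lfloor>s * real (m j)\<rfloor>" for j
    using s by (simp add: k_def)
  have k_le: "k j \<le> m j" for j
  proof -
    have "s * real (m j) \<le> 1 * real (m j)"
      using s by (intro mult_right_mono) auto
    then have "real (k j) \<le> real (m j)"
      unfolding k_eq by linarith
    then show ?thesis by simp
  qed
  have mr: "filterlim (\<lambda>j. real (m j)) at_top sequentially"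
    using filterlim_compose[OF filterlim_real_sequentially m] .
  have inv: "(\<lambda>j. 1 / real (m j)) \<longlonglongrightarrow> 0"
    using tendsto_divide_0[OF tendsto_const filterlim_at_top_imp_at_infinity[OF mr]] .
  have k_lim: "(\<lambda>j. real (k j) / real (m j)) \<longlonglongrightarrow> s"
  proof (rule tendsto_sandwich[of "\<lambda>j. s - 1 / real (m j)" _ _ "\<lambda>_. s"])
    have ev: "eventually (\<lambda>j. m j > 0) sequentially"
      using eventually_compose_filterlim[OF eventually_gt_at_top m] .
    show "eventually (\<lambda>j. s - 1 / real (m j) \<le> real (k j) / real (m j)) sequentially"
      using ev
    proof eventually_elim
      case (elim j)
      have "s * real (m j) - 1 \<le> real (k j)"
        unfolding k_eq by linarith
      then have "(s * real (m j) - 1) / real (m j) \<le> real (k j) / real (m j)"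
        by (rule divide_right_mono) simp
      with elim show ?case by (simp add: diff_divide_distrib)
    qed
    show "eventually (\<lambda>j. real (k j) / real (m j) \<le> s) sequentially"
      using ev
    proof eventually_elim
      case (elim j)
      have "real (k j) \<le> s * real (m j)"
        unfolding k_eq by linarith
      with elim show ?case by (simp add: field_simps)
    qed
    show "(\<lambda>j. s - 1 / real (m j)) \<longlonglongrightarrow> s"
      using tendsto_diff[OF tendsto_const inv, of s] by simp
  qed simp
  have "(\<lambda>j. f (real (k j) / real (m j))) \<longlonglongrightarrow> f s"
    using continuous_on_tendsto_compose[OF cont k_lim s(1)] k_le
    by (auto simp: divide_le_eq)
  then show ?thesis
    unfolding SUP_eq
  proof (rule tendsto_sandwich[rotated 2])
    show "(\<lambda>j. f s) \<longlonglongrightarrow> f s" by simp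
  qed (use grid_max_ge[OF k_le] grid_max_le_SUP[OF cont] SUP_eq in \<open>auto intro!: always_eventually\<close>)
qed

section \<open>Brownian motion on a grid\<close>

locale brownian_motion = prob_space M for M :: "'b measure" +
  fixes B :: "real \<Rightarrow> 'b \<Rightarrow> real"
  assumes standard_brownian_motion: "standard_brownian_motion M B"
begin

lemma B_measurable: "t \<ge> 0 \<Longrightarrow> B t \<in> borel_measurable M"
  using standard_brownian_motion by (simp add: standard_brownian_motion_def)

lemma B_0: "\<omega> \<in> space M \<Longrightarrow> B 0 \<omega> = 0"
  using standard_brownian_motion by (simp add: standard_brownian_motion_def)

lemma B_increment_distributed:
  "0 \<le> s \<Longrightarrow> s < t \<Longrightarrow>
    distributed M lborel (\<lambda>\<omega>. B t \<omega> - B s \<omega>) (normal_density 0 (sqrt (t - s)))"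
  using standard_brownian_motion by (simp add: standard_brownian_motion_def)

lemma B_increments_indep:
  "0 \<le> t 0 \<Longrightarrow> mono_on {..n} t \<Longrightarrow>
    indep_vars (\<lambda>_. borel) (\<lambda>i \<omega>. B (t (Suc i)) \<omega> - B (t i) \<omega>) {..<n}" for n :: nat
  using standard_brownian_motion by (simp add: standard_brownian_motion_def)

lemma B_drift_continuous:
  assumes "\<omega> \<in> space M"
  shows "continuous_on {0..1} (\<lambda>t. B t \<omega> - \<kappa> * sqrt t)"
proof -
  have "continuous_on {0..} (\<lambda>t. B t \<omega>)"
    using standard_brownian_motion assms by (simp add: standard_brownian_motion_def)
  then have "continuous_on {0..1} (\<lambda>t. B t \<omega>)"
    by (rule continuous_on_subset) auto
  then show ?thesis
    by (intro continuous_intros)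
qed

lemma B_increment_fourth_moment:
  assumes "0 \<le> s" "s < t"
  shows "has_bochner_integral M (\<lambda>\<omega>. (B t \<omega> - B s \<omega>) ^ 4) (3 * (t - s)\<^sup>2)"
proof -
  have s: "sqrt (t - s) > 0" using assms by simp
  have *: "has_bochner_integral lborel (\<lambda>x. normal_density 0 (sqrt (t - s)) x * x ^ 4) (3 * (t - s)\<^sup>2)"
    using normal_moment_even[OF s, of 0 2] assms by (simp add: fact_numeral power_divide)
  note D = B_increment_distributed[OF assms]
  have "integrable M (\<lambda>\<omega>. (B t \<omega> - B s \<omega>) ^ 4)"
    using distributed_integrable[OF D, of "\<lambda>x. x ^ 4"] * by (auto simp: has_bochner_integral_iff)
  moreover have "expectation (\<lambda>\<omega>. (B t \<omega> - B s \<omega>) ^ 4) = 3 * (t - s)\<^sup>2"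
    using distributed_integral[OF D, of "\<lambda>x. x ^ 4"] * by (auto simp: has_bochner_integral_iff)
  ultimately show ?thesis
    by (simp add: has_bochner_integral_iff)
qed

lemma B_distributed:
  assumes "t > 0"
  shows "distributed M lborel (B t) (normal_density 0 (sqrt t))"
proof -
  have "distr M lborel (\<lambda>\<omega>. B t \<omega> - B 0 \<omega>) = distr M lborel (B t)"
    by (rule distr_cong) (auto simp: B_0)
  then show ?thesis
    using B_increment_distributed[of 0 t] assms B_measurable[of t] by (simp add: distributed_def)
qed

lemma B_integrable: "t \<ge> 0 \<Longrightarrow> integrable M (B t)"
proof (cases "t = 0")
  case True
  then have "integrable M (B t) \<longleftrightarrow> integrable M (\<lambda>_. 0 :: real)"
    by (intro Bochner_Integration.integrable_cong) (auto simp: B_0)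
  then show ?thesis by simp
next
  case False
  assume "t \<ge> 0"
  with False have t: "t > 0" by simp
  then show ?thesis
    using integrable_normal_moment[of "sqrt t" 0 1]
    by (intro distributed_integrable_var[OF B_distributed]) auto
qed

definition grid_rho :: "nat \<Rightarrow> real \<Rightarrow> real" where
  "grid_rho m \<kappa> = expectation (\<lambda>\<omega>. grid_max (\<lambda>t. B t \<omega> - \<kappa> * sqrt t) m)"

lemma grid_max_integrable: "integrable M (\<lambda>\<omega>. grid_max (\<lambda>t. B t \<omega> - \<kappa> * sqrt t) m)"
  unfolding grid_max_def by (intro integrable_MAX) (auto intro!: B_integrable)

text \<open>
  An integrable upper bound for the largest increment over the grid: \<open>\<bar>x\<bar> \<le> a + x ^ 4 / a ^ 3\<close> holds
  for every \<open>a > 0\<close>, and a maximum of fourth powers is at most their sum. The choice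
  \<open>a = m powr (-1/4)\<close> balances \<open>a\<close> against the expectation \<open>3 / (m * a ^ 3)\<close> of the second term.
\<close>

definition increment_bound :: "nat \<Rightarrow> 'b \<Rightarrow> real" where
  "increment_bound m \<omega> = real m powr (-1/4) +
     real m powr (3/4) * (\<Sum>k<m. (B (real (Suc k) / real m) \<omega> - B (real k / real m) \<omega>) ^ 4)"

lemma increment_le_increment_bound:
  assumes "k < m"
  shows "\<bar>B (real (Suc k) / real m) \<omega> - B (real k / real m) \<omega>\<bar> \<le> increment_bound m \<omega>"
    (is "\<bar>?x\<bar> \<le> _")
proof -
  define a where "a = real m powr (-1/4)"
  have a: "a > 0" using assms by (simp add: a_def)
  have "a ^ 3 = real m powr (-3/4)"
    using assms by (simp add: a_def powr_realpow[symmetric] powr_powr)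
  then have a3: "1 / a ^ 3 = real m powr (3/4)"
    by (simp add: powr_minus_divide)
  have "\<bar>?x\<bar> \<le> a + (1 / a ^ 3) * ?x ^ 4"
  proof (cases "\<bar>?x\<bar> \<le> a")
    case True
    then show ?thesis using a by (simp add: add_increasing2)
  next
    case False
    then have "\<bar>?x\<bar> * a ^ 3 \<le> \<bar>?x\<bar> * \<bar>?x\<bar> ^ 3"
      using a by (intro mult_left_mono power_mono) auto
    also have "\<dots> = ?x ^ 4"
      by (simp add: power4_eq_xxxx power3_eq_cube abs_mult[symmetric] mult.assoc)
    finally have "\<bar>?x\<bar> \<le> (1 / a ^ 3) * ?x ^ 4"
      using a by (simp add: field_simps)
    then show ?thesis using a by simp
  qed
  also have "\<dots> \<le> a + (1 / a ^ 3) *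
      (\<Sum>k<m. (B (real (Suc k) / real m) \<omega> - B (real k / real m) \<omega>) ^ 4)"
    using assms a by (intro add_left_mono mult_left_mono member_le_sum) auto
  finally show ?thesis
    unfolding increment_bound_def a3[symmetric] a_def .
qed

lemma increment_bound_expectation:
  assumes m: "m \<ge> 1"
  shows "has_bochner_integral M (increment_bound m) (4 * real m powr (-1/4))"
proof -
  have "has_bochner_integral M (increment_bound m)
      (real m powr (-1/4) + real m powr (3/4) * (\<Sum>k<m. 3 * (real (Suc k) / real m - real k / real m)\<^sup>2))"
    unfolding increment_bound_def
    using m
    by (intro has_bochner_integral_add has_bochner_integral_mult_right has_bochner_integral_sum
        B_increment_fourth_moment)
       (auto simp: has_bochner_integral_iff prob_space divide_strict_right_mono)
  moreover have "(\<Sum>k<m. 3 * (real (Suc k) / real m - real k / real m)\<^sup>2) = 3 / real m"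
    using m by (simp add: diff_divide_distrib[symmetric] power2_eq_square)
  moreover have "real m powr (3/4) * (3 / real m) = 3 * real m powr (-1/4)"
    using m powr_diff[of "real m" "3/4" 1] by simp
  ultimately show ?thesis
    by (simp add: mult.commute)
qed

lemma grid_rho_double_le:
  assumes "m \<ge> 1"
  shows "grid_rho (2 * m) \<kappa> \<le> grid_rho m \<kappa> + 4 * real (2 * m) powr (-1/4)"
proof -
  note ib = increment_bound_expectation[of "2 * m"]
  have "grid_rho (2 * m) \<kappa> \<le>
      expectation (\<lambda>\<omega>. grid_max (\<lambda>t. B t \<omega> - \<kappa> * sqrt t) m + increment_bound (2 * m) \<omega>)"
    unfolding grid_rho_def
    using assms ib
    by (intro integral_mono Bochner_Integration.integrable_add grid_max_integrable
        grid_max_double_le increment_le_increment_bound)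
       (auto simp: has_bochner_integral_iff)
  also have "\<dots> = grid_rho m \<kappa> + 4 * real (2 * m) powr (-1/4)"
    unfolding grid_rho_def using assms ib
    by (subst Bochner_Integration.integral_add)
       (auto simp: has_bochner_integral_iff intro!: grid_max_integrable)
  finally show ?thesis .
qed

text \<open>
  The refinement errors \<open>4 * (N * 2 ^ i) powr (-1/4)\<close> for \<open>i \<ge> 1\<close> sum to at most \<open>N powr (-1/4)\<close>
  times the constant below, as they are a geometric series with ratio \<open>2 powr (-1/4)\<close>.
\<close>

definition grid_error_const :: real where
  "grid_error_const = 4 / (1 - 2 powr (-1/4))"

lemma grid_rho_dyadic_le:
  assumes "N \<ge> 1"
  shows "grid_rho (N * 2 ^ j) \<kappa> \<le> grid_rho N \<kappa> + grid_error_const * real N powr (-1/4)"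
proof -
  define q :: real where "q = 2 powr (-1/4)"
  have q: "0 < q" "q < 1"
    by (auto simp: q_def powr_less_one)
  have qj: "real (N * 2 ^ j) powr (-1/4) = real N powr (-1/4) * q ^ j" for j
    by (simp add: powr_mult q_def powr_realpow[symmetric] powr_powr mult.commute)
  have "grid_rho (N * 2 ^ j) \<kappa> \<le> grid_rho N \<kappa> + 4 * real N powr (-1/4) * (\<Sum>i<j. q ^ Suc i)"
  proof (induction j)
    case (Suc j)
    have "N * 2 ^ j \<ge> 1" using assms by simp
    from grid_rho_double_le[OF this, of \<kappa>]
    have "grid_rho (N * 2 ^ Suc j) \<kappa> \<le>
        grid_rho (N * 2 ^ j) \<kappa> + 4 * (real N powr (-1/4) * q ^ Suc j)"
      unfolding qj[symmetric] by (simp add: mult_ac)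
    with Suc show ?case
      by (simp add: algebra_simps)
  qed simp
  also have "(\<Sum>i<j. q ^ Suc i) \<le> 1 / (1 - q)"
  proof -
    have "(\<Sum>i<j. q ^ Suc i) \<le> (\<Sum>i<j. q ^ i)"
      using q by (intro sum_mono) (simp add: mult_left_le_one_le)
    also have "\<dots> = (1 - q ^ j) / (1 - q)"
      using q by (simp add: sum_gp_strict)
    also have "\<dots> \<le> 1 / (1 - q)"
      using q by (intro divide_right_mono) auto
    finally show ?thesis .
  qed
  finally show ?thesis
    by (simp add: grid_error_const_def q_def mult_left_mono)
qed

text \<open>
  Each doubling only adds grid points, so along \<open>N * 2 ^ j\<close> the grid maxima increase to the supremum
  while their expectations stay bounded. Monotone convergence then shows that the supremum is
  integrable and that its expectation inherits the bound.
\<close>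

lemma
  assumes N: "N \<ge> 1"
  shows SUP_integrable: "integrable M (\<lambda>\<omega>. SUP t\<in>{0..1}. B t \<omega> - \<kappa> * sqrt t)"
    and rho_le_grid_rho: "rho M B \<kappa> \<le> grid_rho N \<kappa> + grid_error_const * real N powr (-1/4)"
proof -
  define m where "m j = N * 2 ^ j" for j :: nat
  define f where "f j \<omega> = grid_max (\<lambda>t. B t \<omega> - \<kappa> * sqrt t) (m j)" for j \<omega>
  have m_lim: "filterlim m at_top sequentially"
  proof (rule filterlim_at_top_mono)
    show "filterlim (\<lambda>j::nat. j) at_top sequentially"
      by (rule filterlim_ident)
    have "j \<le> m j" for j
    proof -
      have "1 * j \<le> N * 2 ^ j"
        using N by (intro mult_mono less_imp_le[OF less_exp]) auto
      then show ?thesis by (simp add: m_def)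
    qed
    then show "\<forall>\<^sub>F j in sequentially. j \<le> m j"
      by simp
  qed
  have int: "integrable M (f j)" for j
    unfolding f_def by (rule grid_max_integrable)
  have mono: "mono (\<lambda>j. f j \<omega>)" for \<omega>
  proof (rule incseq_SucI)
    fix j
    show "f j \<omega> \<le> f (Suc j) \<omega>"
      using grid_max_double_ge[of "m j"] N by (simp add: f_def m_def mult_ac)
  qed
  have lim: "(\<lambda>j. f j \<omega>) \<longlonglongrightarrow> (SUP t\<in>{0..1}. B t \<omega> - \<kappa> * sqrt t)" if "\<omega> \<in> space M" for \<omega>
    unfolding f_def using B_drift_continuous[OF that] m_lim by (rule grid_max_tendsto_SUP)
  have le: "expectation (f j) \<le> grid_rho N \<kappa> + grid_error_const * real N powr (-1/4)" for j
    using grid_rho_dyadic_le[OF N] by (simp add: f_def[abs_def] m_def grid_rho_def)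
  have "incseq (\<lambda>j. expectation (f j))"
    unfolding incseq_def using mono int by (auto intro!: integral_mono simp: mono_def)
  then obtain x where x: "(\<lambda>j. expectation (f j)) \<longlonglongrightarrow> x"
    using incseq_convergent le by blast
  have meas: "(\<lambda>\<omega>. SUP t\<in>{0..1}. B t \<omega> - \<kappa> * sqrt t) \<in> borel_measurable M"
    using lim by (rule borel_measurable_LIMSEQ_real) (use int in auto)
  have AE_lim: "AE \<omega> in M. (\<lambda>j. f j \<omega>) \<longlonglongrightarrow> (SUP t\<in>{0..1}. B t \<omega> - \<kappa> * sqrt t)"
    using lim by (auto intro: AE_I2)
  show "integrable M (\<lambda>\<omega>. SUP t\<in>{0..1}. B t \<omega> - \<kappa> * sqrt t)"
    using int _ AE_lim x meas by (rule integrable_monotone_convergence) (simp add: mono)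
  have "rho M B \<kappa> = x"
    unfolding rho_def
    using int _ AE_lim x meas by (rule integral_monotone_convergence) (simp add: mono)
  also have "\<dots> \<le> grid_rho N \<kappa> + grid_error_const * real N powr (-1/4)"
    using x le by (intro LIMSEQ_le_const2) auto
  finally show "rho M B \<kappa> \<le> grid_rho N \<kappa> + grid_error_const * real N powr (-1/4)" .
qed

lemma grid_rho_le_rho: "grid_rho N \<kappa> \<le> rho M B \<kappa>"
  unfolding grid_rho_def rho_def
  by (intro integral_mono grid_max_integrable SUP_integrable[of 1] grid_max_le_SUP
      B_drift_continuous) auto

section \<open>Positivity of the Brownian cost\<close>

text \<open>
  \<open>B 1\<close> has mean zero and lies below \<open>\<kappa>\<close> with positive probability, so cutting it off from below at
  \<open>\<kappa>\<close> raises the mean strictly.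
\<close>

lemma expectation_max_B_1_pos: "0 < expectation (\<lambda>\<omega>. max \<kappa> (B 1 \<omega>))"
proof -
  note D = B_distributed[of 1, simplified]
  have int: "integrable M (B 1)" by (simp add: B_integrable)
  have mean: "expectation (B 1) = 0"
    using D by (intro normal_distributed_expectation[of 1]) auto
  define g where "g x = max \<kappa> x - x" for x :: real
  have g: "integrable M (\<lambda>\<omega>. g (B 1 \<omega>))"
    unfolding g_def using int by auto
  have eq: "expectation (\<lambda>\<omega>. g (B 1 \<omega>)) = expectation (\<lambda>\<omega>. max \<kappa> (B 1 \<omega>))"
    unfolding g_def using int mean by (subst Bochner_Integration.integral_diff) auto
  have "\<not> (AE \<omega> in M. g (B 1 \<omega>) = 0)"
  proof
    assume "AE \<omega> in M. g (B 1 \<omega>) = 0"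
    then have "AE x in distr M lborel (B 1). g x = 0"
      using D by (subst AE_distr_iff) (auto simp: g_def distributed_def)
    then have "AE x in lborel. g x = 0"
      unfolding distributed_distr_eq_density[OF D]
      by (subst (asm) AE_density) (auto simp: normal_density_pos)
    then have "AE x in lborel. x \<notin> {..<\<kappa>}"
      by eventually_elim (auto simp: g_def max_def split: if_splits)
    then have "emeasure lborel {..<\<kappa>} = 0"
      by (subst (asm) AE_iff_measurable[of "{..<\<kappa>}"]) auto
    moreover have "emeasure lborel {\<kappa> - 1<..<\<kappa>} \<le> emeasure lborel {..<\<kappa>}"
      by (intro emeasure_mono) auto
    ultimately show False by simp
  qed
  moreover have "0 \<le> expectation (\<lambda>\<omega>. g (B 1 \<omega>))"
    by (intro integral_nonneg_AE) (auto simp: g_def)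
  moreover have "expectation (\<lambda>\<omega>. g (B 1 \<omega>)) = 0 \<longleftrightarrow> (AE \<omega> in M. g (B 1 \<omega>) = 0)"
    using g by (intro integral_nonneg_eq_0_iff_AE) (auto simp: g_def)
  ultimately show ?thesis
    unfolding eq by linarith
qed

text \<open>
  The grid \<open>{0, 1}\<close> gives \<open>\<rho> \<kappa> \<ge> E (max 0 (B 1 - \<kappa>)) = E (max \<kappa> (B 1)) - \<kappa>\<close>. Since lost sales
  are at least as expensive as production, replacing \<open>p\<close> by \<open>c\<close> in front of \<open>\<rho> \<kappa> \<ge> 0\<close> leaves
  \<open>c * E (max \<kappa> (B 1))\<close> as a lower bound. For \<open>p < c\<close> the expression is negative when \<open>\<kappa>\<close> is very
  negative.
\<close>

lemma unit_cost_pos: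
  assumes "0 < c" "c \<le> p"
  shows "0 < c * \<kappa> + p * rho M B \<kappa>"
proof -
  have int: "integrable M (B 1)" by (simp add: B_integrable)
  have grid: "grid_max (\<lambda>t. B t \<omega> - \<kappa> * sqrt t) 1 = max \<kappa> (B 1 \<omega>) - \<kappa>" if "\<omega> \<in> space M" for \<omega>
    using B_0[OF that] by (simp add: grid_max_def atLeast0_atMost_Suc max_def)
  have "grid_rho 1 \<kappa> = expectation (\<lambda>\<omega>. max \<kappa> (B 1 \<omega>) - \<kappa>)"
    unfolding grid_rho_def by (intro Bochner_Integration.integral_cong grid) auto
  also have "\<dots> = expectation (\<lambda>\<omega>. max \<kappa> (B 1 \<omega>)) - \<kappa>"
    using int by (subst Bochner_Integration.integral_diff) (auto simp: prob_space)
  finally have "expectation (\<lambda>\<omega>. max \<kappa> (B 1 \<omega>)) - \<kappa> \<le> rho M B \<kappa>"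
    using grid_rho_le_rho[of 1 \<kappa>] by simp
  moreover have "0 \<le> rho M B \<kappa>"
  proof -
    have "0 \<le> grid_rho 1 \<kappa>"
      unfolding grid_rho_def by (intro integral_nonneg_AE AE_I2) (simp add: grid[unfolded One_nat_def])
    then show ?thesis using grid_rho_le_rho[of 1 \<kappa>] by simp
  qed
  ultimately have "c * (expectation (\<lambda>\<omega>. max \<kappa> (B 1 \<omega>)) - \<kappa>) \<le> p * rho M B \<kappa>"
    using assms by (meson less_imp_le mult_mono' mult_left_mono mult_right_mono order_trans)
  moreover have "0 < c * expectation (\<lambda>\<omega>. max \<kappa> (B 1 \<omega>))"
    using assms expectation_max_B_1_pos by simp
  ultimately show ?thesis
    by (simp add: algebra_simps)
qed

end

section \<open>The random walk as Brownian motion on a grid\<close>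

text \<open>
  The expected lost sales depend only on the joint law of the demands, which is a product of standard
  normal laws. This allows the demands to be exchanged for increments of a Brownian motion that
  lives on another probability space.
\<close>

lemma expectation_lost_sales_PiM:
  assumes "prob_space M" "N \<ge> 1"
    and indep: "prob_space.indep_vars M (\<lambda>_. borel) Z {1..N}"
    and std: "\<And>i. i \<in> {1..N} \<Longrightarrow> distributed M lborel (Z i) std_normal_density"
  shows "prob_space.expectation M (lost_sales Z \<sigma> N \<kappa>) =
    integral\<^sup>L (\<Pi>\<^sub>M i\<in>{1..N}. std_normal_distribution) (lost_sales (\<lambda>i x. x i) \<sigma> N \<kappa>)"
proof -
  interpret prob_space M by fact
  let ?X = "\<lambda>\<omega>. \<lambda>i\<in>{1..N}. Z i \<omega>"
  have meas_Z [measurable]: "Z i \<in> borel_measurable M" if "i \<in> {1..N}" for i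
    using std[OF that] by (simp add: distributed_def)
  have "distr M (\<Pi>\<^sub>M i\<in>{1..N}. borel) ?X = (\<Pi>\<^sub>M i\<in>{1..N}. distr M borel (Z i))"
    using indep_vars_iff_distr_eq_PiM'[where I = "{1..N}" and M' = "\<lambda>_. borel" and X = Z] indep meas_Z \<open>N \<ge> 1\<close> by simp
  also have "\<dots> = (\<Pi>\<^sub>M i\<in>{1..N}. std_normal_distribution)"
  proof (rule PiM_cong)
    fix i assume "i \<in> {1..N}"
    from std[OF this] show "distr M borel (Z i) = std_normal_distribution"
      by (simp add: distributed_def cong: distr_cong)
  qed simp
  finally have law: "distr M (\<Pi>\<^sub>M i\<in>{1..N}. borel) ?X = (\<Pi>\<^sub>M i\<in>{1..N}. std_normal_distribution)" .
  have walk_eq: "walk Z \<sigma> \<kappa> n \<omega> = walk (\<lambda>i x. x i) \<sigma> \<kappa> n (?X \<omega>)" if "n \<in> {0..N}" for n \<omega>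
    using that unfolding walk_def by (auto intro!: sum.cong)
  have "lost_sales Z \<sigma> N \<kappa> = (\<lambda>\<omega>. lost_sales (\<lambda>i x. x i) \<sigma> N \<kappa> (?X \<omega>))"
    unfolding lost_sales_def using walk_eq by (intro ext arg_cong[where f = Max] image_cong) auto
  then have "expectation (lost_sales Z \<sigma> N \<kappa>) =
      expectation (\<lambda>\<omega>. lost_sales (\<lambda>i x. x i) \<sigma> N \<kappa> (?X \<omega>))"
    by simp
  also have "\<dots> = integral\<^sup>L (distr M (\<Pi>\<^sub>M i\<in>{1..N}. borel) ?X) (lost_sales (\<lambda>i x. x i) \<sigma> N \<kappa>)"
  proof (rule integral_distr[symmetric])
    show "?X \<in> measurable M (\<Pi>\<^sub>M i\<in>{1..N}. borel)"
      by (rule measurable_restrict) (rule meas_Z)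
    have "(\<lambda>x. walk (\<lambda>i x. x i) \<sigma> \<kappa> n x) \<in> borel_measurable (\<Pi>\<^sub>M i\<in>{1..N}. borel)"
      if "n \<in> {0..N}" for n
      unfolding walk_def using that
      by (intro borel_measurable_diff borel_measurable_times borel_measurable_sum
          borel_measurable_const measurable_component_singleton) auto
    then show "lost_sales (\<lambda>i x. x i) \<sigma> N \<kappa> \<in> borel_measurable (\<Pi>\<^sub>M i\<in>{1..N}. borel)"
      unfolding lost_sales_def[abs_def] by (intro borel_measurable_Max) auto
  qed
  finally show ?thesis
    unfolding law .
qed

context brownian_motion
begin

lemma scaled_increments:
  fixes N :: nat
  assumes N: "N \<ge> 1"
  defines "Y \<equiv> \<lambda>i \<omega>. sqrt (real N) * (B (real i / real N) \<omega> - B (real (i - 1) / real N) \<omega>)"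
  shows "indep_vars (\<lambda>_. borel) Y {1..N}"
    and "\<And>i. i \<in> {1..N} \<Longrightarrow> distributed M lborel (Y i) std_normal_density"
proof -
  (* The truncated subtraction gives t 0 = t 1 = 0. The increment with index 0 is therefore trivial,
     and those with indices 1 to N are the increments over the N grid intervals. *)
  define t where "t i = real (i - 1) / real N" for i :: nat
  have "indep_vars (\<lambda>_. borel) (\<lambda>i \<omega>. B (t (Suc i)) \<omega> - B (t i) \<omega>) {..<Suc N}"
    by (intro B_increments_indep) (auto simp: t_def mono_on_def divide_right_mono)
  then have "indep_vars (\<lambda>_. borel) (\<lambda>i \<omega>. B (t (Suc i)) \<omega> - B (t i) \<omega>) {1..N}"
    by (rule indep_vars_subset) auto
  from indep_vars_compose2[OF this, of "\<lambda>_ x. sqrt (real N) * x" "\<lambda>_. borel"]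
  show "indep_vars (\<lambda>_. borel) Y {1..N}"
    by (simp add: Y_def t_def)
  fix i assume i: "i \<in> {1..N}"
  have "real i / real N - real (i - 1) / real N = 1 / real N"
    using i by (auto simp: diff_divide_distrib[symmetric])
  moreover have "real (i - 1) / real N < real i / real N"
    using i by (intro divide_strict_right_mono) auto
  ultimately have "distributed M lborel (\<lambda>\<omega>. B (real i / real N) \<omega> - B (real (i - 1) / real N) \<omega>)
      (normal_density 0 (sqrt (1 / real N)))"
    using B_increment_distributed[of "real (i - 1) / real N" "real i / real N"] by simp
  from normal_density_affine[OF this, of "sqrt (real N)" 0]
  show "distributed M lborel (Y i) std_normal_density"
    using N by (simp add: Y_def real_sqrt_divide)
qed

lemma expectation_lost_sales_eq_grid_rho:
  assumes "prob_space M'" and N: "N \<ge> 1" and \<sigma>: "\<sigma> > 0"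
    and "prob_space.indep_vars M' (\<lambda>_. borel) Z {1..N}"
    and "\<And>i. i \<in> {1..N} \<Longrightarrow> distributed M' lborel (Z i) std_normal_density"
  shows "prob_space.expectation M' (lost_sales Z \<sigma> N \<kappa>) = \<sigma> * sqrt (real N) * grid_rho N \<kappa>"
proof -
  define Y where
    "Y i \<omega> = sqrt (real N) * (B (real i / real N) \<omega> - B (real (i - 1) / real N) \<omega>)" for i \<omega>
  define s where "s = \<sigma> * sqrt (real N)"
  have s: "s > 0" using N \<sigma> by (simp add: s_def)
  have "prob_space.expectation M' (lost_sales Z \<sigma> N \<kappa>) =
      integral\<^sup>L (\<Pi>\<^sub>M i\<in>{1..N}. std_normal_distribution) (lost_sales (\<lambda>i x. x i) \<sigma> N \<kappa>)"
    using assms by (intro expectation_lost_sales_PiM)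
  also have "\<dots> = expectation (lost_sales Y \<sigma> N \<kappa>)"
    using N scaled_increments[OF N]
    by (intro expectation_lost_sales_PiM[symmetric]) (auto simp: Y_def[abs_def] prob_space_axioms)
  also have "\<dots> = expectation (\<lambda>\<omega>. s * grid_max (\<lambda>t. B t \<omega> - \<kappa> * sqrt t) N)"
  proof (rule Bochner_Integration.integral_cong[OF refl])
    fix \<omega> assume \<omega>: "\<omega> \<in> space M"
    have sum: "(\<Sum>i=1..n. Y i \<omega>) = sqrt (real N) * B (real n / real N) \<omega>" for n
      by (induction n) (auto simp: Y_def B_0[OF \<omega>] algebra_simps)
    have walk: "walk Y \<sigma> \<kappa> n \<omega> = s * (B (real n / real N) \<omega> - \<kappa> * sqrt (real n / real N))" for n
      unfolding walk_def sum s_def using N by (simp add: real_sqrt_divide algebra_simps)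
    show "lost_sales Y \<sigma> N \<kappa> \<omega> = s * grid_max (\<lambda>t. B t \<omega> - \<kappa> * sqrt t) N"
      unfolding lost_sales_def grid_max_def walk
      using s mono_Max_commute[of "\<lambda>x. s * x"
          "(\<lambda>k. B (real k / real N) \<omega> - \<kappa> * sqrt (real k / real N)) ` {0..N}"]
      by (simp add: image_image mono_def)
  qed
  finally show ?thesis
    by (simp add: grid_rho_def s_def)
qed

end

section \<open>Asymptotic optimality\<close>

theorem theorem9:
  fixes M :: "'a measure" and Z :: "nat \<Rightarrow> 'a \<Rightarrow> real"
    and M' :: "'b measure" and B :: "real \<Rightarrow> 'b \<Rightarrow> real"
    and \<sigma> c p \<kappa>s :: real and N0 :: nat
  assumes "\<sigma> > 0" and "c > 0" and "p \<ge> c"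
    and "prob_space M"
    and "prob_space.indep_vars M (\<lambda>_. borel) Z {1..}"
    and "\<And>i. i \<ge> 1 \<Longrightarrow> distributed M lborel (Z i) std_normal_density"
    and "standard_brownian_motion M' B"
    and "N0 \<ge> 1"
    and "is_arg_min (brownian_cost M' B \<sigma> c p N0) (\<lambda>_. True) \<kappa>s"
  shows "limsup (\<lambda>N. ereal (cost M Z \<sigma> c p N \<kappa>s / optimal_cost M Z \<sigma> c p N)) \<le> 1"
proof -
  interpret brownian_motion M' B
    using assms(7) by (simp add: brownian_motion_def brownian_motion_axioms_def
        standard_brownian_motion_def)
  define g where "g \<kappa> = c * \<kappa> + p * rho M' B \<kappa>" for \<kappa>
  define \<epsilon> where "\<epsilon> N = p * (grid_error_const * real N powr (-1/4))" for N
  have g_pos: "0 < g \<kappa>s"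
    using unit_cost_pos[of c p \<kappa>s] assms by (simp add: g_def)
  have g_min: "g \<kappa>s \<le> g \<kappa>" for \<kappa>
  proof -
    have eq: "brownian_cost M' B \<sigma> c p N0 x = \<sigma> * sqrt (real N0) * g x" for x
      by (simp add: brownian_cost_def g_def algebra_simps)
    show ?thesis
      using assms by (auto simp: is_arg_min_def eq not_less)
  qed
  have cost_eq: "cost M Z \<sigma> c p N \<kappa> = \<sigma> * sqrt (real N) * (c * \<kappa> + p * grid_rho N \<kappa>)"
    if "N \<ge> 1" for N \<kappa>
  proof -
    have "prob_space.indep_vars M (\<lambda>_. borel) Z {1..N}"
      using assms(4,5) by (rule prob_space.indep_vars_subset) auto
    then have "prob_space.expectation M (lost_sales Z \<sigma> N \<kappa>) = \<sigma> * sqrt (real N) * grid_rho N \<kappa>"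
      using assms that by (intro expectation_lost_sales_eq_grid_rho) auto
    then show ?thesis
      by (simp add: cost_def algebra_simps)
  qed
  have upper: "cost M Z \<sigma> c p N \<kappa>s \<le> \<sigma> * sqrt (real N) * g \<kappa>s" if "N \<ge> 1" for N
    unfolding cost_eq[OF that] g_def using assms grid_rho_le_rho
    by (intro mult_left_mono add_left_mono) auto
  have lower: "\<sigma> * sqrt (real N) * (g \<kappa>s - \<epsilon> N) \<le> optimal_cost M Z \<sigma> c p N" if "N \<ge> 1" for N
    unfolding optimal_cost_def
  proof (rule cINF_greatest)
    fix \<kappa>
    have "p * rho M' B \<kappa> \<le> p * (grid_rho N \<kappa> + grid_error_const * real N powr (-1/4))"
      using assms rho_le_grid_rho[OF that] by (intro mult_left_mono) auto
    then have "g \<kappa>s - \<epsilon> N \<le> c * \<kappa> + p * grid_rho N \<kappa>"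
      using g_min[of \<kappa>] by (simp add: g_def \<epsilon>_def algebra_simps)
    then show "\<sigma> * sqrt (real N) * (g \<kappa>s - \<epsilon> N) \<le> cost M Z \<sigma> c p N \<kappa>"
      unfolding cost_eq[OF that] using assms by (intro mult_left_mono) auto
  qed simp
  have "(\<lambda>N. real N powr (-1/4)) \<longlonglongrightarrow> 0"
    by (intro tendsto_neg_powr filterlim_real_sequentially) auto
  then have \<epsilon>_lim: "\<epsilon> \<longlonglongrightarrow> 0"
    unfolding \<epsilon>_def by (intro tendsto_mult_right_zero)
  have "\<forall>\<^sub>F N in sequentially.
      cost M Z \<sigma> c p N \<kappa>s / optimal_cost M Z \<sigma> c p N \<le> g \<kappa>s / (g \<kappa>s - \<epsilon> N)"
    using order_tendstoD(2)[OF \<epsilon>_lim g_pos] eventually_ge_at_top[of 1]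
  proof eventually_elim
    case (elim N)
    define s where "s = \<sigma> * sqrt (real N)"
    have s: "s > 0" using elim assms by (simp add: s_def)
    have "cost M Z \<sigma> c p N \<kappa>s / optimal_cost M Z \<sigma> c p N \<le>
        (s * g \<kappa>s) / (s * (g \<kappa>s - \<epsilon> N))"
      using upper[of N] lower[of N] elim s g_pos by (intro frac_le) (auto simp: s_def)
    then show ?case using s by simp
  qed
  then have "limsup (\<lambda>N. ereal (cost M Z \<sigma> c p N \<kappa>s / optimal_cost M Z \<sigma> c p N)) \<le>
      limsup (\<lambda>N. ereal (g \<kappa>s / (g \<kappa>s - \<epsilon> N)))"
    by (intro Limsup_mono) simp
  also have "\<dots> = ereal 1"
  proof (rule lim_imp_Limsup)
    have "(\<lambda>N. g \<kappa>s / (g \<kappa>s - \<epsilon> N)) \<longlonglongrightarrow> g \<kappa>s / (g \<kappa>s - 0)"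
      using \<epsilon>_lim g_pos by (intro tendsto_intros) auto
    then show "(\<lambda>N. ereal (g \<kappa>s / (g \<kappa>s - \<epsilon> N))) \<longlonglongrightarrow> ereal 1"
      using g_pos by simp
  qed simp
  finally show ?thesis by (simp add: one_ereal_def)
qed

end
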